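(* Fix $d\geq1$, let $X=\mathbb{N}^d$, $\Gamma=\mathbb{N}^d$, and $\mathbf{0}=(0,\dots,0)\in X$. For every $x\in X$ there exists a unique $a\in\Gamma$ such that $g^a(\mathbf{0})=x$. Equivalently, $a\mapsto g^a(\mathbf{0})$ is a bijection from $\Gamma$ to $X$.
   Context: $\mathbb{N}$ denotes the nonnegative integers and $[d]=\{1,\dots,d\}$. For $x=(n_1,\dots,n_d)\in X$ let $\Delta(x)=\{(1,n_1),\dots,(d,n_d)\}\subseteq[d]\times\mathbb{N}$; conversely any set of $d$ points of $[d]\times\mathbb{N}$ with pairwise distinct first coordinates determines an element of $X$. For $\delta=(i,n)\in[d]\times\mathbb{N}$ the seat is $i(\delta)=i$ and the height is $h(\delta)=n+i/d$; points are linearly ordered by height. For $s\in\mathbb{N}$, $\delta+s/d$ denotes the unique point of height $h(\delta)+s/d$. List $\Delta(x)=\{\delta^1(x)\prec\cdots\prec\delta^d(x)\}$ in increasing height. For $j\in[d]$, $g_j:X\to X$ is defined by $g_j(x)=x'$ where $\delta^k(x')=\delta^k(x)$ for $k<j$ and $\delta^k(x')=\delta^k(x)+s_k/d$ for $k\geq j$, with $s_k$ the smallest positive integer such that the seat of $\delta^k(x)+s_k/d$ lies in $\{i(\delta^j(x)),\dots,i(\delta^d(x))\}$. For $a=(a_1,\dots,a_d)\in\Gamma$, $g^a=g_1^{a_1}\circ g_2^{a_2}\circ\cdots\circ g_d^{a_d}$. *)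

theory Defs
  imports Complex_Main "HOL-Library.FuncSet"
begin

definition points :: "nat \<Rightarrow> (nat \<times> nat) set" where
  "points d = {1..d} \<times> UNIV"

(* A point is a pair (seat, n). *)
definition seat :: "nat \<times> nat \<Rightarrow> nat" where
  "seat p = fst p"

definition height :: "nat \<Rightarrow> nat \<times> nat \<Rightarrow> real" where
  "height d p = real (snd p) + real (seat p) / real d"

(* The d-tuples of natural numbers, indexed by {1..d}; both X and Gamma. The functions are
   extensional (fixed value outside {1..d}), so that equality of functions is equality of tuples. *)
definition tuples :: "nat \<Rightarrow> (nat \<Rightarrow> nat) set" where
  "tuples d = {1..d} \<rightarrow>\<^sub>E UNIV"

definition zero_tuple :: "nat \<Rightarrow> nat \<Rightarrow> nat" where
  "zero_tuple d = (\<lambda>i\<in>{1..d}. 0)"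

definition Delta :: "nat \<Rightarrow> (nat \<Rightarrow> nat) \<Rightarrow> (nat \<times> nat) set" where
  "Delta d x = (\<lambda>i. (i, x i)) ` {1..d}"

(* delta d x k is the k-th lowest point of Delta d x, for k = 1, ..., d; list positions start at 0. *)
definition delta :: "nat \<Rightarrow> (nat \<Rightarrow> nat) \<Rightarrow> nat \<Rightarrow> nat \<times> nat" where
  "delta d x k = sorted_key_list_of_set (height d) (Delta d x) ! (k - 1)"

(* The point p + s/d. *)
definition raise :: "nat \<Rightarrow> nat \<times> nat \<Rightarrow> nat \<Rightarrow> nat \<times> nat" where
  "raise d p s = (THE q. q \<in> points d \<and> height d q = height d p + real s / real d)"

(* The number s_k in the definition of gmap d j x. *)
definition climb :: "nat \<Rightarrow> nat \<Rightarrow> (nat \<Rightarrow> nat) \<Rightarrow> nat \<Rightarrow> nat" where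
  "climb d j x k =
     (LEAST s. 0 < s \<and> seat (raise d (delta d x k) s) \<in> (\<lambda>l. seat (delta d x l)) ` {j..d})"

(* For j in {1..d} and x in tuples d there is exactly one such x'. In particular the new points
   are still listed in increasing height and have distinct seats. *)
definition gmap :: "nat \<Rightarrow> nat \<Rightarrow> (nat \<Rightarrow> nat) \<Rightarrow> nat \<Rightarrow> nat" where
  "gmap d j x = (THE x'. x' \<in> tuples d \<and>
     (\<forall>k\<in>{1..d}. delta d x' k =
        (if k < j then delta d x k else raise d (delta d x k) (climb d j x k))))"

(* The composition runs from (gmap d 1)^(a 1) on the outside to (gmap d d)^(a d), applied first. *)
definition gpow :: "nat \<Rightarrow> (nat \<Rightarrow> nat) \<Rightarrow> (nat \<Rightarrow> nat) \<Rightarrow> (nat \<Rightarrow> nat)" where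
  "gpow d a = foldr (\<circ>) (map (\<lambda>j. gmap d j ^^ a j) [1..<Suc d]) id"

end

(* On configurations whose first j - 1 coordinates vanish, the points (1,0), ..., (j-1,0) are the
   j - 1 lowest ones, so g_j fixes them and moves every other point to the next position whose
   seat is in {j..d}. In coordinates this is the map
     (0, ..., 0, x_j, ..., x_d) |-> (0, ..., 0, x_d + 1, x_j, ..., x_(d-1)).
   It is injective, its image consists of the configurations with nonzero j-th coordinate, and it
   increases the sum of the coordinates by one. Hence each configuration vanishing before j is
   g_j^n(y) for a unique n and a unique y vanishing up to j, and the theorem follows by downward
   induction on j. *)
theory Submission
  imports Defs
begin

section \<open>Heights\<close>

text \<open>The seat contributes a fraction in the interval from 0 (excluded) to 1 (included), so a
  smaller integer level always wins and seats only break ties: the order by height is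
  lexicographic.\<close>

lemma height_less_iff:
  assumes "i \<in> {1..d}" "i' \<in> {1..d}"
  shows "height d (i, m) < height d (i', n) \<longleftrightarrow> m < n \<or> m = n \<and> i < i'"
proof -
  have frac: "0 < real k / real d" "real k / real d \<le> 1" if "k \<in> {1..d}" for k
    using that by (auto simp: field_simps)
  have mono: "height d (k, a) < height d (k', b)"
    if "a < b" "k \<in> {1..d}" "k' \<in> {1..d}" for a b k k'
  proof -
    have "real a + 1 \<le> real b" using that(1) by simp
    then show ?thesis
      using frac[OF that(2)] frac[OF that(3)] unfolding height_def seat_def by simp
  qed
  consider "m < n" | "n < m" | "m = n" by linarith
  then show ?thesis
  proof cases
    case 1 then show ?thesis using mono[of m n i i'] assms by simp
  next
    case 2 then show ?thesis using mono[of n m i' i] assms by simp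
  next
    case 3 then show ?thesis using assms by (simp add: height_def seat_def divide_less_cancel)
  qed
qed

lemma height_eq_iff:
  assumes "p \<in> points d" "q \<in> points d"
  shows "height d p = height d q \<longleftrightarrow> p = q"
proof -
  obtain i m j n where pq: "p = (i, m)" "q = (j, n)" by fastforce
  then have ij: "i \<in> {1..d}" "j \<in> {1..d}" using assms by (auto simp: points_def)
  show ?thesis
    using height_less_iff[OF ij, of m n] height_less_iff[OF ij(2) ij(1), of n m]
    by (auto simp: pq)
qed

lemma inj_on_height: "inj_on (height d) (points d)"
  by (simp add: inj_on_def height_eq_iff)

lemma raise_eqI:
  assumes "q \<in> points d" "height d q = height d p + real s / real d"
  shows "raise d p s = q"
  unfolding raise_def
  by (rule the_equality) (use assms in \<open>auto simp flip: height_eq_iff[OF _ assms(1)]\<close>)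

lemma raise_le:
  assumes "1 \<le> i" "i + s \<le> d"
  shows "raise d (i, n) s = (i + s, n)"
  by (rule raise_eqI)
    (use assms in \<open>auto simp: points_def height_def seat_def add_divide_distrib\<close>)

text \<open>Seat \<open>d\<close> contributes exactly 1 to the height, so adding s/d continues on
  the next level from seat 0. Together with \<open>raise_le\<close> this covers every climb computed
  below, since a point under seat \<open>d\<close> moves by one seat only.\<close>

lemma raise_wrap:
  assumes "1 \<le> s" "s \<le> d"
  shows "raise d (d, n) s = (s, Suc n)"
  by (rule raise_eqI) (use assms in \<open>auto simp: points_def height_def seat_def\<close>)

section \<open>Sorted configurations\<close>

definition below :: "nat \<Rightarrow> nat \<times> nat \<Rightarrow> nat \<times> nat \<Rightarrow> bool" where
  "below d p q \<longleftrightarrow> height d p < height d q"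

definition sorted_points :: "nat \<Rightarrow> (nat \<times> nat) set \<Rightarrow> (nat \<times> nat) list" where
  "sorted_points d = sorted_key_list_of_set (height d)"

(* Stated in the class context because an interpretation of folding_insort_key for the type real
   yields facts about linorder.sorted_key_list_of_set instead of the overloaded constant. *)
lemma (in linorder) sorted_key_list_of_set_inj_on:
  fixes f :: "'b \<Rightarrow> 'a"
  assumes "inj_on f S" "A \<subseteq> S" "finite A"
  shows "set (sorted_key_list_of_set f A) = A"
    "sorted_wrt (<) (map f (sorted_key_list_of_set f A))"
    "length (sorted_key_list_of_set f A) = card A"
proof -
  interpret folding_insort_key "(\<le>)" "(<)" S f
    by unfold_locales (rule assms(1))
  show "set (sorted_key_list_of_set f A) = A"
    "sorted_wrt (<) (map f (sorted_key_list_of_set f A))"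
    "length (sorted_key_list_of_set f A) = card A"
    using assms(2,3) by simp_all
qed

lemma (in linorder) sorted_key_list_of_set_eqI:
  fixes f :: "'b \<Rightarrow> 'a"
  assumes "inj_on f S" "set l \<subseteq> S" "sorted_wrt (<) (map f l)"
  shows "sorted_key_list_of_set f (set l) = l"
proof -
  interpret folding_insort_key "(\<le>)" "(<)" S f
    by unfold_locales (rule assms(1))
  show ?thesis
    using assms(2,3) by (intro idem_if_sorted_distinct) (auto simp: strict_sorted_iff distinct_map)
qed

lemma sorted_points:
  assumes "A \<subseteq> points d" "finite A"
  shows "set (sorted_points d A) = A" "sorted_wrt (below d) (sorted_points d A)"
    "length (sorted_points d A) = card A"
  using sorted_key_list_of_set_inj_on[OF inj_on_height assms]
  by (auto simp: sorted_points_def sorted_wrt_map below_def[abs_def])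

text \<open>To compute a sorted configuration it is enough to guess a strictly increasing list with
  the right set of points.\<close>

lemma sorted_points_eqI:
  assumes "set l \<subseteq> points d" "sorted_wrt (below d) l"
  shows "sorted_points d (set l) = l"
  using sorted_key_list_of_set_eqI[OF inj_on_height assms(1)] assms(2)
  by (simp add: sorted_points_def sorted_wrt_map below_def[abs_def])

lemma Delta_subset_points: "Delta d x \<subseteq> points d"
  by (auto simp: Delta_def points_def)

lemma finite_Delta: "finite (Delta d x)"
  by (simp add: Delta_def)

lemma card_Delta: "card (Delta d x) = d"
  by (simp add: Delta_def card_image inj_on_def)

lemmas sorted_points_Delta =
  sorted_points[OF Delta_subset_points finite_Delta, unfolded card_Delta]

lemma delta_eq_nth: "delta d x k = sorted_points d (Delta d x) ! (k - 1)"
  by (simp add: delta_def sorted_points_def)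

lemma Delta_inj:
  assumes "x \<in> tuples d" "y \<in> tuples d" "Delta d x = Delta d y"
  shows "x = y"
proof (rule PiE_ext)
  show "x \<in> {1..d} \<rightarrow>\<^sub>E UNIV" "y \<in> {1..d} \<rightarrow>\<^sub>E UNIV"
    using assms by (simp_all add: tuples_def)
  fix i assume "i \<in> {1..d}"
  then have "(i, x i) \<in> Delta d y" unfolding assms(3)[symmetric] by (simp add: Delta_def)
  then show "x i = y i" by (auto simp: Delta_def)
qed

text \<open>The sorted list determines the set of points and thereby the tuple; this settles
  uniqueness in the definite description of \<open>gmap\<close>.\<close>

lemma tuples_eqI:
  assumes "x \<in> tuples d" "y \<in> tuples d" "\<And>k. k \<in> {1..d} \<Longrightarrow> delta d x k = delta d y k"
  shows "x = y"
proof -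
  have "sorted_points d (Delta d x) = sorted_points d (Delta d y)"
  proof (rule nth_equalityI)
    fix k assume "k < length (sorted_points d (Delta d x))"
    then show "sorted_points d (Delta d x) ! k = sorted_points d (Delta d y) ! k"
      using assms(3)[of "Suc k"] by (simp add: sorted_points_Delta delta_eq_nth)
  qed (simp add: sorted_points_Delta)
  then have "Delta d x = Delta d y" by (metis sorted_points_Delta(1))
  then show ?thesis using Delta_inj assms by blast
qed

section \<open>Configurations vanishing on the first seats\<close>

text \<open>The filtration along which the induction descends: all tuples for j = 1, only
  \<open>zero_tuple d\<close> for j = \<open>Suc d\<close>. It is used for configurations and for
  exponents alike.\<close>

definition vanishing :: "nat \<Rightarrow> nat \<Rightarrow> (nat \<Rightarrow> nat) set" where
  "vanishing d j = {x \<in> tuples d. \<forall>i\<in>{1..<j}. x i = 0}"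

text \<open>Coordinates before \<open>j\<close> are copied rather than set to 0, so that
  \<open>Delta_shift\<close> and \<open>sum_shift\<close> hold for every \<open>x\<close>.\<close>

definition shift :: "nat \<Rightarrow> nat \<Rightarrow> (nat \<Rightarrow> nat) \<Rightarrow> nat \<Rightarrow> nat" where
  "shift d j x = (\<lambda>i\<in>{1..d}. if i < j then x i else if i = j then Suc (x d) else x (i - 1))"

text \<open>The pointwise form of \<open>shift\<close>, through which the order of the points can be
  followed.\<close>

definition step :: "nat \<Rightarrow> nat \<Rightarrow> nat \<times> nat \<Rightarrow> nat \<times> nat" where
  "step d j p = (if fst p < j then p else if fst p < d then (Suc (fst p), snd p)
     else (j, Suc (snd p)))"

text \<open>Points at seats before \<open>j\<close> have level 0 and a smaller seat than all others,
  so they come first in the lexicographic order.\<close>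

lemma sorted_points_vanishing:
  assumes "x \<in> vanishing d j" "j \<in> {1..d}"
  shows "sorted_points d (Delta d x) =
    map (\<lambda>i. (i, 0)) [1..<j] @ sorted_points d ((\<lambda>i. (i, x i)) ` {j..d})"
    (is "_ = ?low @ sorted_points d ?A")
proof -
  have A: "?A \<subseteq> points d" "finite ?A" using assms(2) by (auto simp: points_def)
  have "{1..d} = {1..<j} \<union> {j..d}" using assms(2) by auto
  then have set_eq: "set (?low @ sorted_points d ?A) = Delta d x"
    using assms(1) by (auto simp: Delta_def sorted_points[OF A] vanishing_def image_Un)
  have "sorted_wrt (below d) ?low"
    unfolding sorted_wrt_map
    by (rule sorted_wrt_mono_rel[OF _ sorted_wrt_upt])
      (use assms(2) in \<open>auto simp: below_def height_less_iff\<close>)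
  moreover have "below d p q" if "p \<in> set ?low" "q \<in> ?A" for p q
    using that assms(2) by (auto simp: below_def height_less_iff)
  ultimately have "sorted_wrt (below d) (?low @ sorted_points d ?A)"
    by (auto simp: sorted_wrt_append sorted_points[OF A])
  from sorted_points_eqI[OF _ this] show ?thesis
    unfolding set_eq by (simp add: Delta_subset_points)
qed

lemma delta_vanishing_low:
  assumes "x \<in> vanishing d j" "j \<in> {1..d}" "k \<in> {1..<j}"
  shows "delta d x k = (k, 0)"
  using assms by (auto simp: delta_eq_nth sorted_points_vanishing nth_append)

text \<open>The order of the upper points may stay unknown: \<open>climb\<close> depends only on the
  set of their seats, which is now seen to be \<open>{j..d}\<close>.\<close>

lemma delta_vanishing_high:
  assumes "x \<in> vanishing d j" "j \<in> {1..d}"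
  shows "delta d x ` {j..d} = (\<lambda>i. (i, x i)) ` {j..d}" (is "_ = ?A")
proof -
  have A: "?A \<subseteq> points d" "finite ?A" using assms(2) by (auto simp: points_def)
  have len: "length (sorted_points d ?A) = Suc d - j"
    by (simp add: sorted_points[OF A] card_image inj_on_def)
  \<comment> \<open>The low block has length j - 1, so position k - 1 of the whole list is position
    k - j of the upper block.\<close>
  have "delta d x ` {j..d} = (\<lambda>k. sorted_points d ?A ! (k - j)) ` {j..d}"
    by (rule image_cong)
      (use assms in \<open>auto simp: delta_eq_nth sorted_points_vanishing nth_append\<close>)
  also have "\<dots> = (!) (sorted_points d ?A) ` ((\<lambda>k. k - j) ` {j..d})"
    by (simp add: image_image)
  also have "(\<lambda>k. k - j) ` {j..d} = {..<Suc d - j}"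
  proof
    show "{..<Suc d - j} \<subseteq> (\<lambda>k. k - j) ` {j..d}"
    proof
      fix k assume "k \<in> {..<Suc d - j}"
      then show "k \<in> (\<lambda>k. k - j) ` {j..d}" by (intro image_eqI[of _ _ "k + j"]) auto
    qed
  qed auto
  also have "(!) (sorted_points d ?A) ` \<dots> = set (sorted_points d ?A)"
    using len by (auto simp: set_conv_nth)
  finally show ?thesis by (simp add: sorted_points[OF A])
qed

section \<open>The coordinate form of g_j\<close>

lemma shift_in_vanishing: "x \<in> vanishing d j \<Longrightarrow> shift d j x \<in> vanishing d j"
  by (auto simp: vanishing_def shift_def tuples_def)

lemma Delta_shift:
  assumes "j \<in> {1..d}"
  shows "Delta d (shift d j x) = step d j ` Delta d x"
proof
  show "Delta d (shift d j x) \<subseteq> step d j ` Delta d x"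
  proof
    fix p assume "p \<in> Delta d (shift d j x)"
    then obtain i where i: "i \<in> {1..d}" "p = (i, shift d j x i)" by (auto simp: Delta_def)
    \<comment> \<open>The seat from which \<open>step\<close> arrives at seat
      \<open>i\<close>.\<close>
    define i' where "i' = (if i < j then i else if i = j then d else i - 1)"
    have "p = step d j (i', x i')" using i assms by (auto simp: i'_def step_def shift_def)
    moreover have "i' \<in> {1..d}" using i assms by (auto simp: i'_def)
    ultimately show "p \<in> step d j ` Delta d x" by (auto simp: Delta_def)
  qed
  show "step d j ` Delta d x \<subseteq> Delta d (shift d j x)"
    using assms by (auto simp: Delta_def step_def shift_def image_iff)
qed

text \<open>\<open>step\<close> is strictly increasing on the points of \<open>x\<close>, so it maps
  the sorted list to the sorted list. The wrap from (d, n) to (j, n + 1) respects the order, since a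
  point of \<open>x\<close> above (d, n) has level at least n + 1 and moves to a seat beyond
  \<open>j\<close>.\<close>

lemma delta_shift:
  assumes "x \<in> vanishing d j" "j \<in> {1..d}" "k \<in> {1..d}"
  shows "delta d (shift d j x) k = step d j (delta d x k)"
proof -
  let ?L = "sorted_points d (Delta d x)"
  have "below d (step d j p) (step d j q)"
    if "p \<in> Delta d x" "q \<in> Delta d x" "below d p q" for p q
  proof -
    obtain i i' where pq: "i \<in> {1..d}" "i' \<in> {1..d}" "p = (i, x i)" "q = (i', x i')"
      using \<open>p \<in> Delta d x\<close> \<open>q \<in> Delta d x\<close> by (auto simp: Delta_def)
    \<comment> \<open>Hence the points fixed by \<open>step\<close> lie below all the points that it
      moves.\<close>
    have zero: "a < j \<Longrightarrow> x a = 0" if "a \<in> {1..d}" for a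
      using assms(1) that by (auto simp: vanishing_def)
    have lt: "x i < x i' \<or> x i = x i' \<and> i < i'"
      using \<open>below d p q\<close> pq by (simp add: below_def height_less_iff)
    show ?thesis
      using pq lt zero[of i] zero[of i'] assms(2)
      by (auto simp: below_def step_def height_less_iff)
  qed
  then have "sorted_wrt (below d) (map (step d j) ?L)"
    unfolding sorted_wrt_map
    by (intro sorted_wrt_mono_rel[OF _ sorted_points_Delta(2)])
      (simp add: sorted_points_Delta)
  moreover have set_eq: "set (map (step d j) ?L) = Delta d (shift d j x)"
    using assms(2) by (simp add: sorted_points_Delta Delta_shift)
  ultimately have "sorted_points d (Delta d (shift d j x)) = map (step d j) ?L"
    using sorted_points_eqI[of "map (step d j) ?L" d] Delta_subset_points by metis
  then show ?thesis
    using assms(3) nth_map[of "k - 1" ?L "step d j"]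
    by (simp add: delta_eq_nth sorted_points_Delta(3) less_diff_conv2)
qed

text \<open>From a seat in \<open>{j..<d}\<close> the next seat is already admissible, so the climb
  is 1. From seat \<open>d\<close> the climb runs through seats 1, 2, ... of the next level, and the
  first admissible one is \<open>j\<close>, so the climb is \<open>j\<close>.\<close>

lemma raise_climb_eq_step:
  assumes "x \<in> vanishing d j" "j \<in> {1..d}" "k \<in> {j..d}"
  shows "raise d (delta d x k) (climb d j x k) = step d j (delta d x k)"
proof -
  have high: "(\<lambda>l. seat (delta d x l)) ` {j..d} = {j..d}"
    using arg_cong[OF delta_vanishing_high[OF assms(1,2)], of "image seat"]
    by (simp add: image_image seat_def)
  have "delta d x k \<in> (\<lambda>i. (i, x i)) ` {j..d}"
    using delta_vanishing_high[OF assms(1,2)] assms(3) by blast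
  then obtain i where i: "i \<in> {j..d}" "delta d x k = (i, x i)" by blast
  have climb: "climb d j x k = (LEAST s. 0 < s \<and> seat (raise d (i, x i) s) \<in> {j..d})"
    by (simp add: climb_def high i)
  show ?thesis
  proof (cases "i < d")
    case True
    then have r: "raise d (i, x i) 1 = (Suc i, x i)" using i assms(2) by (subst raise_le) auto
    have "climb d j x k = 1"
      unfolding climb by (rule Least_equality) (use r True i in \<open>auto simp: seat_def\<close>)
    then show ?thesis using i True r by (simp add: step_def)
  next
    case False
    then have "i = d" using i by simp
    have r: "raise d (i, x i) j = (j, Suc (x i))"
      using \<open>i = d\<close> assms(2) by (simp add: raise_wrap)
    have "climb d j x k = j"
      unfolding climb
    proof (rule Least_equality)
      show "0 < j \<and> seat (raise d (i, x i) j) \<in> {j..d}" using r assms(2) by (simp add: seat_def)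
      fix s assume s: "0 < s \<and> seat (raise d (i, x i) s) \<in> {j..d}"
      show "j \<le> s"
      proof (rule ccontr)
        assume "\<not> j \<le> s"
        then have "raise d (i, x i) s = (s, Suc (x i))"
          using \<open>i = d\<close> assms(2) s by (simp add: raise_wrap)
        with s \<open>\<not> j \<le> s\<close> show False by (simp add: seat_def)
      qed
    qed
    then show ?thesis using i \<open>i = d\<close> r by (simp add: step_def)
  qed
qed

text \<open>By \<open>delta_shift\<close> and \<open>raise_climb_eq_step\<close>,
  \<open>shift d j x\<close> has the property that defines \<open>gmap\<close>, and
  \<open>tuples_eqI\<close> excludes any other candidate.\<close>

lemma gmap_eq_shift:
  assumes "x \<in> vanishing d j" "j \<in> {1..d}"
  shows "gmap d j x = shift d j x"
  unfolding gmap_def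
proof (rule the_equality)
  have "delta d (shift d j x) k =
      (if k < j then delta d x k else raise d (delta d x k) (climb d j x k))"
    if "k \<in> {1..d}" for k
    using that assms delta_vanishing_low[OF assms, of k]
    by (auto simp: delta_shift raise_climb_eq_step step_def)
  moreover have "shift d j x \<in> tuples d"
    using shift_in_vanishing[OF assms(1)] by (simp add: vanishing_def)
  ultimately show P: "shift d j x \<in> tuples d \<and> (\<forall>k\<in>{1..d}. delta d (shift d j x) k =
      (if k < j then delta d x k else raise d (delta d x k) (climb d j x k)))"
    by simp
  fix y assume y: "y \<in> tuples d \<and> (\<forall>k\<in>{1..d}. delta d y k =
      (if k < j then delta d x k else raise d (delta d x k) (climb d j x k)))"
  show "y = shift d j x"
  proof (rule tuples_eqI[of y d])
    show "delta d y k = delta d (shift d j x) k" if "k \<in> {1..d}" for k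
      using y P that by metis
  qed (use y P in simp_all)
qed

section \<open>Iterating an injection with well-founded inverse\<close>

text \<open>Pulling an element back along \<open>f\<close> lowers \<open>\<mu>\<close>, so it ends
  after finitely many steps at an element outside the image of \<open>f\<close>. Injectivity makes
  the number of steps and the end point unique.\<close>

lemma bij_betw_funpow:
  fixes f :: "'a \<Rightarrow> 'a" and \<mu> :: "'a \<Rightarrow> nat"
  assumes "inj_on f A" "f ` A \<subseteq> A" and dec: "\<And>x. x \<in> A \<Longrightarrow> \<mu> x < \<mu> (f x)"
  shows "bij_betw (\<lambda>(n, y). (f ^^ n) y) (UNIV \<times> (A - f ` A)) A"
proof -
  have mem: "(f ^^ n) y \<in> A" if "y \<in> A" for n y
    using that assms(2) by (induction n) auto
  have inj: "n = n' \<and> y = y'"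
    if "(f ^^ n) y = (f ^^ n') y'" "y \<in> A - f ` A" "y' \<in> A - f ` A" for n n' y y'
    using that(1)
  proof (induction n arbitrary: n')
    case 0
    \<comment> \<open>A positive \<open>n'\<close> would put \<open>y\<close> into the image of
      \<open>f\<close>.\<close>
    with that mem show ?case by (cases n') auto
  next
    case (Suc n)
    show ?case
    proof (cases n')
      case 0 with Suc.prems that mem show ?thesis by auto
    next
      case (Suc m)
      then have "(f ^^ n) y = (f ^^ m) y'"
        using Suc.prems that mem assms(1) by (auto dest: inj_onD)
      then show ?thesis using Suc.IH Suc by blast
    qed
  qed
  have surj: "\<exists>n. \<exists>y \<in> A - f ` A. x = (f ^^ n) y" if "x \<in> A" for x
    using that
  proof (induction "\<mu> x" arbitrary: x rule: less_induct)
    case less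
    show ?case
    proof (cases "x \<in> f ` A")
      case True
      then obtain z where z: "z \<in> A" "x = f z" by blast
      then obtain n y where "y \<in> A - f ` A" "z = (f ^^ n) y" using less.hyps dec by blast
      then show ?thesis using z by (intro exI[of _ "Suc n"] bexI[of _ y]) auto
    next
      case False
      then show ?thesis using less.prems by (intro exI[of _ 0] bexI[of _ x]) auto
    qed
  qed
  show ?thesis
    unfolding bij_betw_def
  proof
    show "inj_on (\<lambda>(n, y). (f ^^ n) y) (UNIV \<times> (A - f ` A))"
      using inj by (fastforce simp: inj_on_def)
    show "(\<lambda>(n, y). (f ^^ n) y) ` (UNIV \<times> (A - f ` A)) = A"
      using mem surj by (fastforce simp: image_iff)
  qed
qed

section \<open>Peeling off one coordinate at a time\<close>

text \<open>Coordinates from \<open>j\<close> on can be read off the image: coordinate i < d stands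
  at position \<open>Suc i\<close>, and the successor of coordinate \<open>d\<close> at position
  \<open>j\<close>.\<close>

lemma inj_on_shift:
  assumes "j \<in> {1..d}"
  shows "inj_on (shift d j) (vanishing d j)"
proof (rule inj_onI)
  fix x y assume xy: "x \<in> vanishing d j" "y \<in> vanishing d j" and eq: "shift d j x = shift d j y"
  show "x = y"
  proof (rule PiE_ext)
    show "x \<in> {1..d} \<rightarrow>\<^sub>E UNIV" "y \<in> {1..d} \<rightarrow>\<^sub>E UNIV"
      using xy by (simp_all add: vanishing_def tuples_def)
    fix i assume i: "i \<in> {1..d}"
    consider "i < j" | "j \<le> i" "i < d" | "i = d" using i by fastforce
    then show "x i = y i"
    proof cases
      case 1 then show ?thesis using i xy by (simp add: vanishing_def)
    next
      case 2 then show ?thesis using i fun_cong[OF eq, of "Suc i"] by (simp add: shift_def)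
    next
      case 3 then show ?thesis using assms fun_cong[OF eq, of j] by (simp add: shift_def)
    qed
  qed
qed

text \<open>Identifies the starting points in \<open>bij_betw_funpow\<close> with the next set of
  the filtration.\<close>

lemma vanishing_minus_shift:
  assumes "j \<in> {1..d}"
  shows "vanishing d j - shift d j ` vanishing d j = vanishing d (Suc j)"
proof
  have "shift d j x j \<noteq> 0" for x using assms by (simp add: shift_def)
  moreover have "y j = 0" if "y \<in> vanishing d (Suc j)" for y
    using that assms by (simp add: vanishing_def)
  ultimately have "vanishing d (Suc j) \<inter> shift d j ` vanishing d j = {}" by blast
  then show "vanishing d (Suc j) \<subseteq> vanishing d j - shift d j ` vanishing d j"
    by (auto simp: vanishing_def)
  show "vanishing d j - shift d j ` vanishing d j \<subseteq> vanishing d (Suc j)"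
  proof
    fix y assume y: "y \<in> vanishing d j - shift d j ` vanishing d j"
    have "y j = 0"
    proof (rule ccontr)
      assume "y j \<noteq> 0"
      \<comment> \<open>The backward shift; its last entry is a true predecessor because
        \<open>y j\<close> is nonzero.\<close>
      define x where "x = (\<lambda>i\<in>{1..d}. if i < j then y i else if i < d then y (Suc i) else y j - 1)"
      have "x \<in> vanishing d j" using y by (auto simp: vanishing_def x_def tuples_def)
      moreover have "shift d j x = y"
      proof (rule PiE_ext)
        show "shift d j x \<in> {1..d} \<rightarrow>\<^sub>E UNIV" "y \<in> {1..d} \<rightarrow>\<^sub>E UNIV"
          using y by (simp_all add: vanishing_def tuples_def shift_def)
        show "shift d j x i = y i" if "i \<in> {1..d}" for i
          using that assms \<open>y j \<noteq> 0\<close> by (auto simp: shift_def x_def)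
      qed
      ultimately show False using y by blast
    qed
    then show "y \<in> vanishing d (Suc j)" using y by (auto simp: vanishing_def less_Suc_eq)
  qed
qed

text \<open>The coordinates from \<open>j\<close> on are rotated and one of them grows by one. The
  sum thus serves as the measure \<open>\<mu>\<close>.\<close>

lemma sum_shift:
  assumes "j \<in> {1..d}"
  shows "sum (shift d j x) {1..d} = Suc (sum x {1..d})"
proof -
  have split: "{1..d} = {1..<j} \<union> {j..d}" using assms by auto
  have "sum (shift d j x) {1..d} = sum (shift d j x) {1..<j} + sum (shift d j x) {j..d}"
    unfolding split by (rule sum.union_disjoint) auto
  also have "sum (shift d j x) {1..<j} = sum x {1..<j}"
    by (rule sum.cong) (use assms in \<open>auto simp: shift_def\<close>)
  also have "sum (shift d j x) {j..d} = Suc (x d) + sum (shift d j x) {Suc j..d}"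
    using assms by (subst sum.atLeast_Suc_atMost) (auto simp: shift_def)
  also have "sum (shift d j x) {Suc j..d} = sum (\<lambda>i. x (i - 1)) {Suc j..d}"
    by (rule sum.cong) (use assms in \<open>auto simp: shift_def\<close>)
  also have "\<dots> = sum x {j..<d}"
    by (rule sum.reindex_bij_witness[of _ Suc "\<lambda>i. i - 1"]) auto
  also have "sum x {1..<j} + (Suc (x d) + sum x {j..<d}) =
      Suc (sum x {1..<j} + (sum x {j..<d} + x d))"
    by simp
  also have "sum x {j..<d} + x d = sum x {j..d}"
    using assms by (simp add: sum.last_plus add.commute)
  also have "sum x {1..<j} + sum x {j..d} = sum x {1..d}"
    unfolding split by (rule sum.union_disjoint[symmetric]) auto
  finally show ?thesis .
qed

lemma bij_betw_gmap_funpow: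
  assumes "j \<in> {1..d}"
  shows "bij_betw (\<lambda>(n, y). (gmap d j ^^ n) y) (UNIV \<times> vanishing d (Suc j)) (vanishing d j)"
proof -
  have image: "gmap d j ` vanishing d j = shift d j ` vanishing d j"
    using assms by (simp add: gmap_eq_shift)
  have "inj_on (gmap d j) (vanishing d j)"
    using inj_on_shift[OF assms] assms
    by (simp add: inj_on_cong[of "vanishing d j" "gmap d j" "shift d j"] gmap_eq_shift)
  moreover have "gmap d j ` vanishing d j \<subseteq> vanishing d j"
    using shift_in_vanishing image by auto
  moreover have "sum x {1..d} < sum (gmap d j x) {1..d}" if "x \<in> vanishing d j" for x
    using that assms sum_shift[OF assms, of x] by (simp add: gmap_eq_shift)
  ultimately have "bij_betw (\<lambda>(n, y). (gmap d j ^^ n) y)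
      (UNIV \<times> (vanishing d j - gmap d j ` vanishing d j)) (vanishing d j)"
    by (rule bij_betw_funpow[where \<mu> = "\<lambda>x. sum x {1..d}"])
  then show ?thesis by (simp only: image vanishing_minus_shift[OF assms])
qed

text \<open>The counterpart for exponents of peeling off powers of g_j from a configuration.\<close>

lemma bij_betw_split_coordinate:
  assumes "j \<in> {1..d}"
  shows "bij_betw (\<lambda>a. (a j, a(j := 0))) (vanishing d j) (UNIV \<times> vanishing d (Suc j))"
proof (rule bij_betw_byWitness[where f' = "\<lambda>(n, b). b(j := n)"])
  show "\<forall>b\<in>UNIV \<times> vanishing d (Suc j).
      (\<lambda>a. (a j, a(j := 0))) (case b of (n, b) \<Rightarrow> b(j := n)) = b"
    using assms by (auto simp: vanishing_def fun_upd_idem)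
  show "(\<lambda>a. (a j, a(j := 0))) ` vanishing d j \<subseteq> UNIV \<times> vanishing d (Suc j)"
    using assms by (auto simp: vanishing_def tuples_def PiE_iff extensional_def)
  show "(\<lambda>(n, b). b(j := n)) ` (UNIV \<times> vanishing d (Suc j)) \<subseteq> vanishing d j"
    using assms by (auto simp: vanishing_def tuples_def PiE_iff extensional_def)
qed simp

section \<open>Downward induction over the tails of the composition\<close>

text \<open>The tail of \<open>gpow\<close> that starts with g_j: all of \<open>gpow\<close> for j =
  1, the identity for j = \<open>Suc d\<close>.\<close>

definition gpow_from :: "nat \<Rightarrow> nat \<Rightarrow> (nat \<Rightarrow> nat) \<Rightarrow> (nat \<Rightarrow> nat) \<Rightarrow> nat \<Rightarrow> nat" where
  "gpow_from d j a = foldr (\<circ>) (map (\<lambda>i. gmap d i ^^ a i) [j..<Suc d]) id"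

text \<open>The tail ignores the exponent at \<open>j\<close>; resetting it to 0 places the
  remaining exponents in \<open>vanishing d (Suc j)\<close>, where the induction hypothesis
  applies.\<close>

lemma gpow_from_Cons:
  assumes "j \<le> d"
  shows "gpow_from d j a x = (gmap d j ^^ a j) (gpow_from d (Suc j) (a(j := 0)) x)"
proof -
  have map_eq: "map (\<lambda>i. gmap d i ^^ a i) [Suc j..<Suc d] =
      map (\<lambda>i. gmap d i ^^ (a(j := 0)) i) [Suc j..<Suc d]"
    by (rule map_cong) auto
  have "[j..<Suc d] = j # [Suc j..<Suc d]"
    using assms by (simp add: upt_conv_Cons del: upt_Suc)
  then show ?thesis
    unfolding gpow_from_def map_eq[symmetric] by (simp del: upt_Suc)
qed

text \<open>The map is a composite of three bijections: split \<open>a\<close> into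
  \<open>a j\<close> and the rest, send the rest to a configuration y by the induction hypothesis,
  and apply g_j to y \<open>a j\<close> times.\<close>

lemma bij_betw_gpow_from:
  assumes "1 \<le> j" "j \<le> Suc d"
  shows "bij_betw (\<lambda>a. gpow_from d j a (zero_tuple d)) (vanishing d j) (vanishing d j)"
  using assms(2,1)
proof (induction j rule: inc_induct)
  case base
  have "vanishing d (Suc d) = {zero_tuple d}"
    by (auto simp: vanishing_def tuples_def zero_tuple_def PiE_iff extensional_def fun_eq_iff)
  then show ?case by (simp add: gpow_from_def bij_betw_def)
next
  case (step j)
  then have j: "j \<in> {1..d}" by simp
  let ?H = "\<lambda>a. gpow_from d (Suc j) a (zero_tuple d)"
  have "bij_betw (map_prod id ?H) (UNIV \<times> vanishing d (Suc j)) (UNIV \<times> vanishing d (Suc j))"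
    by (intro bij_betw_map_prod step.IH) simp_all
  note bij_betw_trans[OF bij_betw_trans[OF bij_betw_split_coordinate[OF j] this]
      bij_betw_gmap_funpow[OF j]]
  moreover have "(\<lambda>(n, y). (gmap d j ^^ n) y) \<circ> (map_prod id ?H \<circ> (\<lambda>a. (a j, a(j := 0)))) =
      (\<lambda>a. gpow_from d j a (zero_tuple d))"
    using j by (auto simp: fun_eq_iff gpow_from_Cons)
  ultimately show ?case by simp
qed

theorem theorem4p2:
  fixes d :: nat
  assumes "d \<ge> 1"
  shows "(\<forall>x \<in> tuples d. \<exists>!a. a \<in> tuples d \<and> gpow d a (zero_tuple d) = x) \<and>
    bij_betw (\<lambda>a. gpow d a (zero_tuple d)) (tuples d) (tuples d)"
proof -
  have "vanishing d 1 = tuples d" by (simp add: vanishing_def)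
  then have bij: "bij_betw (\<lambda>a. gpow d a (zero_tuple d)) (tuples d) (tuples d)"
    using bij_betw_gpow_from[of 1 d] by (simp add: gpow_from_def gpow_def)
  have "\<exists>!a. a \<in> tuples d \<and> gpow d a (zero_tuple d) = x" if x: "x \<in> tuples d" for x
  proof -
    have "x \<in> (\<lambda>a. gpow d a (zero_tuple d)) ` tuples d"
      using bij x by (simp add: bij_betw_def)
    then obtain a where a: "a \<in> tuples d" "gpow d a (zero_tuple d) = x" by auto
    show ?thesis
    proof (rule ex1I[of _ a])
      fix b assume b: "b \<in> tuples d \<and> gpow d b (zero_tuple d) = x"
      show "b = a" by (rule inj_onD[OF bij_betw_imp_inj_on[OF bij]]) (use a b in simp_all)
    qed (use a in simp)
  qed
  with bij show ?thesis by blast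
qed

end
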